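(* Let $\tau:\mathbb{R}\to\mathbb{R}$ be the Takagi function, viewed as a continuous periodic function of period $1$, and let $\{c_n : n\in\mathbb{Z}\}$ be its Fourier coefficients. Define the power series $$f(z) = \tfrac{1}{2}c_0 + \sum_{n=1}^{\infty} c_n z^n .$$ This power series converges absolutely in the closed unit disk $\{z\in\mathbb{C} : |z|\le 1\}$ to define a holomorphic function in its interior, and it has the unit circle as a natural boundary to analytic continuation. It defines a continuous function on the boundary of the unit disk, and its values there satisfy, for real $\theta$, $$f(e^{2\pi i\theta}) = \tfrac{1}{2}\left(X(\theta) + i\,Y(\theta)\right),$$ with $X(\theta), Y(\theta)$ real-valued, in which $X(\theta)=\tau(\theta)$ is the Takagi function.
   Context: The Takagi function is $\tau(x) = \sum_{n=0}^{\infty} \frac{1}{2^n}\,\langle\!\langle 2^n x\rangle\!\rangle$, where $\langle\!\langle x\rangle\!\rangle$ denotes the distance from the real number $x$ to the nearest integer; this formula defines a continuous function on $\mathbb{R}$, periodic of period $1$. Its Fourier coefficients are $c_n = \int_0^1 \tau(x) e^{-2\pi i n x}\,dx$ for $n\in\mathbb{Z}$. That the unit circle is a natural boundary for $f$ means that $f$, holomorphic in $|z|<1$, cannot be analytically continued across any arc of the unit circle. *)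

theory Defs
  imports "HOL-Complex_Analysis.Complex_Analysis"
begin

text \<open>
  The distance from \<open>x\<close> to the nearest integer; its minimality is
  \<open>round_diff_minimal\<close>.
\<close>
definition dist_nearest_int :: "real \<Rightarrow> real" where
  "dist_nearest_int x = \<bar>x - of_int (round x)\<bar>"

definition takagi :: "real \<Rightarrow> real" where
  "takagi x = (\<Sum>n. 1 / 2 ^ n * dist_nearest_int (2 ^ n * x))"

definition fourier_coeff :: "(real \<Rightarrow> complex) \<Rightarrow> int \<Rightarrow> complex" where
  "fourier_coeff g n =
     integral {0..1} (\<lambda>x. g x * exp (- 2 * of_real pi * \<i> * of_int n * of_real x))"

definition takagi_coeff :: "int \<Rightarrow> complex" where
  "takagi_coeff = fourier_coeff (\<lambda>x. of_real (takagi x))"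

text \<open>The summation index is shifted by one, so that the series starts at \<open>n = 1\<close>.\<close>
definition takagi_power_series :: "complex \<Rightarrow> complex" where
  "takagi_power_series z =
     1 / 2 * takagi_coeff 0 + (\<Sum>n. takagi_coeff (int (Suc n)) * z ^ Suc n)"

definition continues_analytically_across :: "(complex \<Rightarrow> complex) \<Rightarrow> complex set \<Rightarrow> bool" where
  "continues_analytically_across f A \<longleftrightarrow>
     (\<exists>U g. open U \<and> A \<subseteq> U \<and> g holomorphic_on U \<and> (\<forall>z\<in>U \<inter> ball 0 1. g z = f z))"

text \<open>
  The arcs of the unit circle are the nondegenerate open arcs
  \<open>{cis t | a < t < b}\<close>; only the values of \<open>f\<close> in the open unit disk matter.
\<close>
definition unit_circle_natural_boundary :: "(complex \<Rightarrow> complex) \<Rightarrow> bool" where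
  "unit_circle_natural_boundary f \<longleftrightarrow>
     f holomorphic_on ball 0 1 \<and>
     (\<forall>a b. a < b \<longrightarrow> \<not> continues_analytically_across f (cis ` {a<..<b}))"

lemma dist_nearest_int_nonneg: "0 \<le> dist_nearest_int x"
  by (simp add: dist_nearest_int_def)

lemma dist_nearest_int_le: "dist_nearest_int x \<le> 1 / 2"
  using of_int_round_abs_le[of x] by (simp add: dist_nearest_int_def abs_minus_commute)

lemma dist_nearest_int_lipschitz: "\<bar>dist_nearest_int x - dist_nearest_int y\<bar> \<le> \<bar>x - y\<bar>"
  using round_diff_minimal[of x "round y"] round_diff_minimal[of y "round x"]
  unfolding dist_nearest_int_def by linarith

lemma dist_nearest_int_add_int: "dist_nearest_int (x + of_int k) = dist_nearest_int x"
proof -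
  have "round (x + of_int k) = round x + k"
    using floor_add_int[of "x + 1 / 2" k] by (simp add: round_def ac_simps)
  then show ?thesis by (simp add: dist_nearest_int_def)
qed

lemma continuous_on_dist_nearest_int: "continuous_on UNIV dist_nearest_int"
proof -
  have "1-lipschitz_on UNIV dist_nearest_int"
    by (intro lipschitz_onI) (simp_all add: dist_real_def dist_nearest_int_lipschitz)
  then show ?thesis by (rule lipschitz_on_continuous_on)
qed

lemma takagi_term_bound: "norm (1 / 2 ^ n * dist_nearest_int (2 ^ n * x)) \<le> (1 / 2) ^ n"
proof -
  have "\<bar>dist_nearest_int (2 ^ n * x)\<bar> \<le> 1"
    using dist_nearest_int_nonneg[of "2 ^ n * x"] dist_nearest_int_le[of "2 ^ n * x"] by linarith
  then show ?thesis by (simp add: abs_mult power_one_over divide_right_mono)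
qed

lemma summable_takagi: "summable (\<lambda>n. 1 / 2 ^ n * dist_nearest_int (2 ^ n * x))"
  by (rule summable_comparison_test'[where g = "\<lambda>n. (1 / 2) ^ n" and N = 0])
     (use takagi_term_bound in \<open>auto intro: summable_geometric\<close>)

lemma continuous_on_takagi: "continuous_on UNIV takagi"
proof -
  have "uniform_limit UNIV (\<lambda>N x. \<Sum>n<N. 1 / 2 ^ n * dist_nearest_int (2 ^ n * x))
          (\<lambda>x. \<Sum>n. 1 / 2 ^ n * dist_nearest_int (2 ^ n * x)) sequentially"
    by (rule Weierstrass_m_test[where M = "\<lambda>n. (1 / 2) ^ n"])
       (use takagi_term_bound in \<open>auto intro: summable_geometric\<close>)
  then have "uniform_limit UNIV (\<lambda>N x. \<Sum>n<N. 1 / 2 ^ n * dist_nearest_int (2 ^ n * x))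
          takagi sequentially"
    by (simp add: takagi_def[abs_def])
  then show ?thesis
    by (rule uniform_limit_theorem[rotated])
       (auto intro!: always_eventually continuous_intros
          continuous_on_compose2[OF continuous_on_dist_nearest_int])
qed

lemma takagi_periodic: "takagi (x + 1) = takagi x"
proof -
  have "dist_nearest_int (2 ^ n * (x + 1)) = dist_nearest_int (2 ^ n * x)" for n
    using dist_nearest_int_add_int[of "2 ^ n * x" "2 ^ n"] by (simp add: algebra_simps)
  then show ?thesis by (simp add: takagi_def)
qed

end

theory Submission
  imports Defs
begin

text \<open>
  Everything rests on two facts about the Takagi function \<open>\<tau>\<close>: its Fourier coefficients \<open>c\<^sub>n\<close>
  are absolutely summable, and it has no derivative at dyadic rationals.

  Summability comes from the self-similarity \<open>\<tau>(x) = d(x) + \<tau>(2x) / 2\<close>, where \<open>d\<close> is the distance to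
  the nearest integer; let \<open>d\<^sub>n\<close> be the Fourier coefficients of \<open>d\<close>. Replacing \<open>x\<close> by \<open>2x\<close> moves
  the \<open>n\<close>-th coefficient of a function to index \<open>2n\<close>, so for \<open>n > 0\<close> the modulus
  \<open>\<bar>c\<^sub>n\<bar>\<close> is at most \<open>\<bar>d\<^sub>n\<bar>\<close>, plus \<open>\<bar>c\<^sub>m\<bar> / 2\<close> when \<open>n = 2m\<close>. As \<open>d\<close> is piecewise
  linear and continuous, \<open>d\<^sub>n\<close> is \<open>O(1 / n\<^sup>2)\<close>. Hence the partial sums \<open>S\<^sub>N\<close> of \<open>\<Sum>\<bar>c\<^sub>n\<bar>\<close> satisfy
  \<open>S\<^sub>N \<le> \<Sum>\<bar>d\<^sub>n\<bar> + S\<^sub>N / 2\<close> and are bounded (\<open>summable_takagi_coeff\<close>). The power series \<open>f\<close> therefore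
  converges uniformly on the closed disk, where it is continuous, and it is holomorphic inside.

  Since \<open>\<tau>\<close> is real and even, the \<open>c\<^sub>n\<close> are real, and the real part of \<open>2 f(e\<^sup>2\<^sup>\<pi>\<^sup>i\<^sup>\<theta>)\<close> is the cosine
  series of \<open>\<tau>\<close>. An even continuous periodic function with summable cosine coefficients is the sum of its
  cosine series (\<open>cosine_series_sums\<close>): the difference of the two is orthogonal to all polynomials
  in \<open>cos(2\<pi>x)\<close>, and these are uniformly dense in the continuous even periodic functions by
  the Weierstrass theorem. So \<open>\<tau>(\<theta>) = 2 Re f(e\<^sup>2\<^sup>\<pi>\<^sup>i\<^sup>\<theta>)\<close>.

  For the natural boundary, a continuation \<open>g\<close> of \<open>f\<close> across an arc agrees with \<open>f\<close> on the arc, by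
  continuity of \<open>f\<close> up to the boundary. Then \<open>\<tau>(\<theta>) = 2 Re g(e\<^sup>2\<^sup>\<pi>\<^sup>i\<^sup>\<theta>)\<close> is differentiable in \<open>\<theta>\<close>
  along the arc. But every arc contains a point whose \<open>\<theta>\<close> is dyadic, and there the difference
  quotients of \<open>\<tau>\<close> tend to infinity (\<open>takagi_not_differentiable_at_dyadic\<close>).
\<close>

section \<open>Cosine series of even periodic functions\<close>

definition cos_coeff :: "(real \<Rightarrow> real) \<Rightarrow> nat \<Rightarrow> real" where
  "cos_coeff g n = integral {0..1} (\<lambda>x. g x * cos (2 * pi * real n * x))"

lemma has_integral_cos_int:
  fixes k :: int
  shows "((\<lambda>x. cos (2 * pi * of_int k * x)) has_integral (if k = 0 then 1 else 0)) {0..1}"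
proof (cases "k = 0")
  case True
  then show ?thesis
    using has_integral_const_real[of "1 :: real" 0 1] by simp
next
  case False
  have "((\<lambda>x. cos (2 * pi * of_int k * x)) has_integral
      (sin (2 * pi * of_int k * 1) / (2 * pi * of_int k) - sin (2 * pi * of_int k * 0) / (2 * pi * of_int k))) {0..1}"
    using False
    by (intro fundamental_theorem_of_calculus)
       (auto intro!: derivative_eq_intros simp flip: has_real_derivative_iff_has_vector_derivative)
  moreover have "sin (2 * pi * of_int k) = 0"
    by (metis sin_int_2pin)
  ultimately show ?thesis
    using False by simp
qed

lemma has_integral_cos_mult_cos:
  fixes m n :: nat
  shows "((\<lambda>x. cos (2 * pi * real n * x) * cos (2 * pi * real m * x)) has_integral
     (if n = m then (if m = 0 then 1 else 1 / 2) else 0)) {0..1}"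
proof -
  have "((\<lambda>x. (cos (2 * pi * of_int (int n - int m) * x) + cos (2 * pi * of_int (int n + int m) * x)) / 2)
      has_integral ((if int n - int m = 0 then 1 else 0) + (if int n + int m = 0 then 1 else 0)) / 2) {0..1}"
    by (intro has_integral_divide has_integral_add has_integral_cos_int)
  moreover have "(cos (2 * pi * of_int (int n - int m) * x) + cos (2 * pi * of_int (int n + int m) * x)) / 2
      = cos (2 * pi * real n * x) * cos (2 * pi * real m * x)" for x :: real
  proof -
    have "2 * pi * of_int (int n - int m) * x = 2 * pi * real n * x - 2 * pi * real m * x"
      "2 * pi * of_int (int n + int m) * x = 2 * pi * real n * x + 2 * pi * real m * x"
      by (simp_all add: algebra_simps)
    then show ?thesis by (simp only: cos_times_cos)
  qed
  moreover have "int n - int m = 0 \<longleftrightarrow> n = m" "int n + int m = 0 \<longleftrightarrow> n = m \<and> m = 0"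
    by auto
  ultimately show ?thesis
    by (cases "n = m"; cases "m = 0") simp_all
qed

text \<open>
  Induction on the power: multiplying by \<open>cos(2\<pi>x)\<close> turns \<open>cos(2\<pi>nx)\<close> into the mean of its two
  neighbours \<open>cos(2\<pi>(n\<plusminus>1)x)\<close>, so the claim has to be made for all frequencies at once.
\<close>
lemma cos_powers_orthogonal_if_cos_coeffs_zero:
  assumes D: "continuous_on UNIV D" and 0: "\<And>n. cos_coeff D n = 0"
  shows "((\<lambda>x. D x * cos (2 * pi * x) ^ k * cos (2 * pi * real n * x)) has_integral 0) {0..1}"
proof (induction k arbitrary: n)
  case 0
  have "(\<lambda>x. D x * cos (2 * pi * real n * x)) integrable_on {0..1}"
    by (intro integrable_continuous_real continuous_intros continuous_on_subset[OF D]) auto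
  then show ?case
    using 0 assms(2)[of n] by (simp add: cos_coeff_def has_integral_iff)
next
  case (Suc k)
  show ?case
  proof (cases n)
    case 0
    then show ?thesis using Suc[of 1] by (simp add: mult_ac)
  next
    case n: (Suc m)
    have "((\<lambda>x. (D x * cos (2 * pi * x) ^ k * cos (2 * pi * real m * x)
         + D x * cos (2 * pi * x) ^ k * cos (2 * pi * real (Suc (Suc m)) * x)) / 2)
       has_integral (0 + 0) / 2) {0..1}"
      by (intro has_integral_divide has_integral_add Suc)
    moreover have "(D x * cos (2 * pi * x) ^ k * cos (2 * pi * real m * x)
         + D x * cos (2 * pi * x) ^ k * cos (2 * pi * real (Suc (Suc m)) * x)) / 2
       = D x * cos (2 * pi * x) ^ Suc k * cos (2 * pi * real n * x)" for x
    proof -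
      have "cos (2 * pi * real n * x) * cos (2 * pi * x)
          = (cos (2 * pi * real m * x) + cos (2 * pi * real (Suc (Suc m)) * x)) / 2"
        by (simp add: cos_times_cos n algebra_simps)
      then have "2 * (D x * cos (2 * pi * x) ^ k * (cos (2 * pi * real n * x) * cos (2 * pi * x)))
          = D x * cos (2 * pi * x) ^ k * (cos (2 * pi * real m * x) + cos (2 * pi * real (Suc (Suc m)) * x))"
        by (simp del: of_nat_Suc)
      then show ?thesis by (simp add: field_simps del: of_nat_Suc)
    qed
    ultimately show ?thesis by simp
  qed
qed

text \<open>
  This reduces approximation by cosine polynomials to polynomial approximation on \<open>[-1, 1]\<close>: by
  symmetry the function is determined by its values on \<open>[0, 1/2]\<close>, where \<open>x \<mapsto> cos(2\<pi>x)\<close> is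
  injective.
\<close>
lemma even_periodic_factors_through_cos:
  assumes D: "continuous_on UNIV D" "\<And>x. D (- x) = D x" "\<And>x. D (x + 1) = D x"
  obtains G :: "real \<Rightarrow> real" where "continuous_on {-1..1} G" "\<And>x. x \<in> {0..1} \<Longrightarrow> D x = G (cos (2 * pi * x))"
proof
  show "continuous_on {-1..1} (\<lambda>y. D (arccos y / (2 * pi)))"
    by (intro continuous_intros continuous_on_compose2[OF D(1)]) auto
  fix x :: real assume x: "x \<in> {0..1}"
  show "D x = D (arccos (cos (2 * pi * x)) / (2 * pi))"
  proof (cases "x \<le> 1 / 2")
    case True
    then have "arccos (cos (2 * pi * x)) = 2 * pi * x" using x
      by (intro arccos_cos) auto
    then show ?thesis by simp
  next
    case False
    have "cos (2 * pi * x) = cos (2 * pi - 2 * pi * x)" 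
      by (simp add: cos_diff)
    also have "\<dots> = cos (2 * pi * (1 - x))" by (simp add: algebra_simps)
    also have "arccos \<dots> = 2 * pi * (1 - x)"
      using x False by (intro arccos_cos) auto
    finally have "arccos (cos (2 * pi * x)) = 2 * pi * (1 - x)" .
    then show ?thesis using D(2)[of x] D(3)[of "- x"] by (simp add: add.commute)
  qed
qed

lemma periodic_eq_frac:
  fixes D :: "real \<Rightarrow> 'a"
  assumes "\<And>x. D (x + 1) = D x"
  shows "D x = D (frac x)"
proof -
  \<comment> \<open>Translate by natural numbers only: upwards from the fractional part, or from a negative \<open>x\<close> up to it.\<close>
  have nat: "D (x + real n) = D x" for n x
  proof (induction n)
    case (Suc n)
    then show ?case using assms[of "x + real n"] by (simp add: add_ac)
  qed simp
  have "D x = D (frac x)" if "\<lfloor>x\<rfloor> \<ge> 0"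
    using nat[of "frac x" "nat \<lfloor>x\<rfloor>"] that by (simp add: frac_def)
  moreover have "D x = D (frac x)" if "\<lfloor>x\<rfloor> < 0"
    using nat[of x "nat (- \<lfloor>x\<rfloor>)"] that by (simp add: frac_def)
  ultimately show ?thesis by linarith
qed

text \<open>
  Approximating \<open>D\<close> uniformly within \<open>e\<close> by a polynomial \<open>g(cos(2\<pi>x))\<close>, to which \<open>D\<close> is orthogonal,
  gives \<open>\<integral>D\<^sup>2 = \<integral>D (D - g(cos(2\<pi>x))) \<le> e \<integral>\<bar>D\<bar>\<close> for every \<open>e > 0\<close>.
\<close>
lemma cos_coeffs_zero_imp_zero:
  assumes D: "continuous_on UNIV D" "\<And>x. D (- x) = D x" "\<And>x. D (x + 1) = D x"
    and 0: "\<And>n. cos_coeff D n = 0"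
  shows "D x = 0"
proof -
  obtain G :: "real \<Rightarrow> real" where G: "continuous_on {-1..1} G" "\<And>x. x \<in> {0..1} \<Longrightarrow> D x = G (cos (2 * pi * x))"
    using even_periodic_factors_through_cos[OF D] by blast
  have contD: "continuous_on A D" for A using D(1) continuous_on_subset by blast
  define K where "K = integral {0..1} (\<lambda>x. \<bar>D x\<bar>)"
  have K: "((\<lambda>x. \<bar>D x\<bar>) has_integral K) {0..1}"
    unfolding K_def by (intro integrable_integral integrable_continuous_real continuous_intros contD)
  have int2: "(\<lambda>x. D x ^ 2) integrable_on {0..1}"
    by (intro integrable_continuous_real continuous_intros contD)
  have "integral {0..1} (\<lambda>x. D x ^ 2) \<le> e * K" if e: "e > 0" for e
  proof -
    obtain g :: "real \<Rightarrow> real" where g: "real_polynomial_function g" "\<And>y. y \<in> {-1..1} \<Longrightarrow> \<bar>G y - g y\<bar> < e"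
      using Stone_Weierstrass_real_polynomial_function[OF _ G(1) e] by auto
    obtain a N where gs: "g = (\<lambda>y. \<Sum>i\<le>N. a i * y ^ i)"
      using g(1) real_polynomial_function_iff_sum by blast
    have "((\<lambda>x. \<Sum>i\<le>N. a i * (D x * cos (2 * pi * x) ^ i * cos (2 * pi * real 0 * x))) has_integral (\<Sum>i\<le>N. a i * 0)) {0..1}"
      by (intro has_integral_sum has_integral_mult_right cos_powers_orthogonal_if_cos_coeffs_zero D 0) auto
    then have g0: "((\<lambda>x. D x * g (cos (2 * pi * x))) has_integral 0) {0..1}"
      by (simp add: gs sum_distrib_left mult_ac)
    have "((\<lambda>x. D x ^ 2 - D x * g (cos (2 * pi * x))) has_integral (integral {0..1} (\<lambda>x. D x ^ 2) - 0)) {0..1}"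
      by (intro has_integral_diff g0 integrable_integral int2)
    moreover have "((\<lambda>x. e * \<bar>D x\<bar>) has_integral e * K) {0..1}"
      by (intro has_integral_mult_right K)
    moreover have "D x ^ 2 - D x * g (cos (2 * pi * x)) \<le> e * \<bar>D x\<bar>" if "x \<in> {0..1}" for x
    proof -
      have "D x ^ 2 - D x * g (cos (2 * pi * x)) = D x * (G (cos (2 * pi * x)) - g (cos (2 * pi * x)))"
        using G(2)[OF that] by (simp add: power2_eq_square algebra_simps)
      also have "\<dots> \<le> \<bar>D x\<bar> * \<bar>G (cos (2 * pi * x)) - g (cos (2 * pi * x))\<bar>"
        by (metis abs_ge_self abs_mult)
      also have "\<dots> \<le> \<bar>D x\<bar> * e"
        using g(2)[of "cos (2 * pi * x)"] by (intro mult_left_mono) auto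
      finally show ?thesis by (simp add: mult.commute)
    qed
    ultimately have "integral {0..1} (\<lambda>x. D x ^ 2) - 0 \<le> e * K"
      by (rule has_integral_le)
    then show ?thesis by simp
  qed
  note le = this
  have "integral {0..1} (\<lambda>x. D x ^ 2) \<le> 0"
  proof (rule tendsto_le[OF trivial_limit_at_right_real])
    show "((\<lambda>e. e * K) \<longlongrightarrow> 0) (at_right 0)"
      by (auto intro!: tendsto_eq_intros)
    show "((\<lambda>e. integral {0..1} (\<lambda>x. D x ^ 2)) \<longlongrightarrow> integral {0..1} (\<lambda>x. D x ^ 2)) (at_right (0::real))"
      by simp
    show "\<forall>\<^sub>F e in at_right 0. integral {0..1} (\<lambda>x. (D x)\<^sup>2) \<le> e * K"
      using eventually_at_right_less by (rule eventually_mono) (use le in auto)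
  qed
  moreover have "integral {0..1} (\<lambda>x. D x ^ 2) \<ge> 0"
    by (intro integral_nonneg int2) auto
  ultimately have "integral {0..1} (\<lambda>x. D x ^ 2) = 0" by linarith
  moreover have "continuous_on {0..1} (\<lambda>x. D x ^ 2)"
    by (intro continuous_intros contD)
  ultimately have "\<forall>x\<in>{0..1}. D x ^ 2 = 0"
    using integral_eq_0_iff[of 0 1 "\<lambda>x. D x ^ 2"] by simp
  then have "D (frac x) = 0"
    by (simp add: frac_ge_0 less_imp_le[OF frac_lt_1])
  then show ?thesis
    using periodic_eq_frac[of D x] D(3) by simp
qed

text \<open>
  By uniform convergence the cosine series may be integrated term by term, so its sum has the same
  cosine coefficients as \<open>g\<close>; uniqueness of coefficients finishes the proof. The factor 2 is the
  inverse of the mean value of \<open>cos\<^sup>2\<close>.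
\<close>
lemma cosine_series_sums:
  assumes g: "continuous_on UNIV g" "\<And>x. g (- x) = g x" "\<And>x. g (x + 1) = g x"
    and summable: "summable (\<lambda>n. \<bar>cos_coeff g (Suc n)\<bar>)"
  shows "(\<lambda>n. 2 * cos_coeff g (Suc n) * cos (2 * pi * real (Suc n) * \<theta>)) sums (g \<theta> - cos_coeff g 0)"
proof -
  define a where "a = cos_coeff g"
  define u where "u = (\<lambda>n x. 2 * a (Suc n) * cos (2 * pi * real (Suc n) * x))"
  define S where "S = (\<lambda>x. a 0 + (\<Sum>n. u n x))"
  have contg: "continuous_on A g" for A using g(1) continuous_on_subset by blast
  have M: "summable (\<lambda>n. 2 * \<bar>a (Suc n)\<bar>)"
    using summable by (simp add: a_def)
  have u_le: "norm (u n x) \<le> 2 * \<bar>a (Suc n)\<bar>" for n x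
    by (simp add: u_def abs_mult mult_left_le)
  have sum_u: "summable (\<lambda>n. u n x)" for x
    by (rule summable_comparison_test'[OF M u_le])
  have "uniform_limit UNIV (\<lambda>N x. \<Sum>n<N. u n x) (\<lambda>x. \<Sum>n. u n x) sequentially"
    by (rule Weierstrass_m_test[OF _ M]) (use u_le in auto)
  then have "continuous_on UNIV (\<lambda>x. \<Sum>n. u n x)"
    by (rule uniform_limit_theorem[rotated]) (auto intro!: always_eventually continuous_intros simp: u_def)
  then have contS: "continuous_on UNIV S"
    unfolding S_def by (intro continuous_intros)
  have "cos_coeff S m = a m" for m
  proof -
    let ?c = "\<lambda>x. cos (2 * pi * real m * x)"
    have "uniform_limit {0..1} (\<lambda>N x. \<Sum>n<N. u n x * ?c x) (\<lambda>x. \<Sum>n. u n x * ?c x) sequentially"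
    proof (rule Weierstrass_m_test[OF _ M])
      fix n x
      have "norm (u n x * ?c x) \<le> norm (u n x)"
        by (simp add: abs_mult mult_left_le)
      then show "norm (u n x * ?c x) \<le> 2 * \<bar>a (Suc n)\<bar>" using u_le order_trans by blast
    qed
    then obtain I J where I: "\<And>N. ((\<lambda>x. \<Sum>n<N. u n x * ?c x) has_integral I N) {0..1}"
      and J: "((\<lambda>x. \<Sum>n. u n x * ?c x) has_integral J) {0..1}" and IJ: "I \<longlonglongrightarrow> J"
      by (rule uniform_limit_integral) (auto intro!: continuous_intros simp: u_def)
    \<comment> \<open>Orthogonality: only the summand with frequency \<open>m\<close> contributes to the \<open>m\<close>-th coefficient.\<close>
    have u0: "((\<lambda>x. u n x * ?c x) has_integral (if Suc n = m then a m else 0)) {0..1}" for n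
      using has_integral_mult_right[OF has_integral_cos_mult_cos[of "Suc n" m], of "2 * a (Suc n)"]
      by (auto simp: u_def mult_ac split: if_splits)
    have "((\<lambda>x. \<Sum>n<N. u n x * ?c x) has_integral (\<Sum>n<N. if Suc n = m then a m else 0)) {0..1}" for N
      by (intro has_integral_sum u0) auto
    then have "I N = (\<Sum>n<N. if Suc n = m then a m else 0)" for N
      using I has_integral_unique by blast
    moreover have "(\<Sum>n<N. if Suc n = m then a m else 0) = (if m = 0 then 0 else a m)" if "N \<ge> m" for N
      using that by (cases m) (auto simp: sum.delta)
    ultimately have "eventually (\<lambda>N. I N = (if m = 0 then 0 else a m)) sequentially"
      unfolding eventually_sequentially by metis
    then have "J = (if m = 0 then 0 else a m)"
      using IJ LIMSEQ_unique tendsto_eventually by blast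
    moreover have "((\<lambda>x. a 0 * (cos (2 * pi * real 0 * x) * ?c x) + (\<Sum>n. u n x * ?c x)) has_integral
        (a 0 * (if 0 = m then (if m = 0 then 1 else 1 / 2) else 0) + J)) {0..1}"
      by (intro has_integral_add has_integral_mult_right has_integral_cos_mult_cos J)
    moreover have "(\<Sum>n. u n x * ?c x) = (\<Sum>n. u n x) * ?c x" for x
      using suminf_mult2[OF sum_u] by simp
    ultimately have "((\<lambda>x. S x * ?c x) has_integral a m) {0..1}"
      by (auto simp: S_def algebra_simps split: if_splits)
    then show ?thesis by (simp add: cos_coeff_def integral_unique)
  qed
  note S_coeff = this
  have "g \<theta> - S \<theta> = 0"
  proof (rule cos_coeffs_zero_imp_zero[of "\<lambda>x. g x - S x"])
    show "continuous_on UNIV (\<lambda>x. g x - S x)"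
      by (intro continuous_intros contg contS)
    fix x
    have "u n (- x) = u n x" for n by (simp add: u_def)
    then show "g (- x) - S (- x) = g x - S x" by (simp add: g S_def)
    have "u n (x + 1) = u n x" for n
    proof -
      have "cos (2 * pi * real (Suc n) * (x + 1)) = cos (2 * pi * real (Suc n) * x + 2 * pi * real (Suc n))"
        by (simp add: algebra_simps)
      also have "\<dots> = cos (2 * pi * real (Suc n) * x)"
        using cos_int_2pin[of "int (Suc n)"] sin_int_2pin[of "int (Suc n)"]
        by (simp add: cos_add del: of_nat_Suc)
      finally show ?thesis by (simp add: u_def)
    qed
    then show "g (x + 1) - S (x + 1) = g x - S x" by (simp add: g S_def)
  next
    fix m
    have "cos_coeff (\<lambda>x. g x - S x) m = cos_coeff g m - cos_coeff S m"
      unfolding cos_coeff_def left_diff_distrib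
      by (intro integral_diff integrable_continuous_real continuous_intros contg continuous_on_subset[OF contS]) auto
    then show "cos_coeff (\<lambda>x. g x - S x) m = 0" by (simp add: S_coeff a_def)
  qed
  then show ?thesis
    using summable_sums[OF sum_u[of \<theta>]] by (simp add: S_def u_def a_def)
qed

text \<open>
  The sine part vanishes because \<open>g(x) sin(2\<pi>nx)\<close> is odd and has period 1.
\<close>
lemma fourier_coeff_even_real:
  fixes g :: "real \<Rightarrow> real"
  assumes g: "continuous_on UNIV g" "\<And>x. g (- x) = g x" "\<And>x. g (x + 1) = g x"
  shows "fourier_coeff (\<lambda>x. of_real (g x)) (int n) = of_real (cos_coeff g n)"
proof -
  define h where "h = (\<lambda>x. g x * sin (2 * pi * real n * x))"
  have contg: "continuous_on A g" for A using g(1) continuous_on_subset by blast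
  have conth: "continuous_on A h" for A
    unfolding h_def by (intro continuous_intros contg)
  have "h (x + 1) = h x" for x
  proof -
    have "sin (2 * pi * real n * (x + 1)) = sin (2 * pi * real n * x + 2 * pi * real n)"
      by (simp add: algebra_simps)
    also have "\<dots> = sin (2 * pi * real n * x)"
      using cos_int_2pin[of "int n"] sin_int_2pin[of "int n"] by (simp add: sin_add)
    finally show ?thesis by (simp add: h_def g)
  qed
  then have "integral {0..1} h = integral {-1..0} h"
    using integral_shift[of "-1" 1 0 h] conth by (simp add: o_def)
  also have "\<dots> = integral {0..1} (\<lambda>x. - h x)"
    using Henstock_Kurzweil_Integration.integral_reflect_real[of 1 0 "\<lambda>x. h (- x)"] by (simp add: h_def g(2))
  finally have "integral {0..1} h = 0" by simp
  then have "(h has_integral 0) {0..1}"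
    using conth integrable_continuous_real has_integral_iff by blast
  then have S: "((\<lambda>x. of_real (h x)) has_integral (0 :: complex)) {0..1}"
    using has_integral_linear[OF _ bounded_linear_of_real, of h 0] by (simp add: o_def)
  have "(\<lambda>x. g x * cos (2 * pi * real n * x)) integrable_on {0..1}"
    by (intro integrable_continuous_real continuous_intros contg)
  then have "((\<lambda>x. g x * cos (2 * pi * real n * x)) has_integral cos_coeff g n) {0..1}"
    unfolding cos_coeff_def by (rule integrable_integral)
  from has_integral_linear[OF this bounded_linear_of_real]
  have C: "((\<lambda>x. of_real (g x * cos (2 * pi * real n * x))) has_integral (of_real (cos_coeff g n) :: complex)) {0..1}"
    by (simp add: o_def)
  have "of_real (g x) * exp (- 2 * of_real pi * \<i> * of_int (int n) * of_real x)
      = of_real (g x * cos (2 * pi * real n * x)) - \<i> * of_real (h x)" for x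
  proof -
    have "exp (- 2 * of_real pi * \<i> * of_int (int n) * of_real x) = cis (- (2 * pi * real n * x))"
      by (simp add: cis_conv_exp mult_ac)
    then show ?thesis
      by (simp add: h_def complex_eq_iff)
  qed
  moreover have "((\<lambda>x. of_real (g x * cos (2 * pi * real n * x)) - \<i> * of_real (h x)) has_integral
      (of_real (cos_coeff g n) - \<i> * 0)) {0..1}"
    by (intro has_integral_diff C has_integral_mult_right S)
  ultimately show ?thesis
    by (simp add: fourier_coeff_def integral_unique)
qed

section \<open>Absolute summability of the coefficients\<close>

text \<open>
  The integrand has period \<open>1/2\<close> up to the sign \<open>(-1)\<^sup>n\<close>: for odd \<open>n\<close> the two halves of \<open>[0, 1]\<close>
  cancel, for even \<open>n\<close> they agree and rescale to the integral defining the \<open>n/2\<close>-th coefficient.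
\<close>
lemma fourier_coeff_dilate_2:
  assumes g: "continuous_on UNIV g" "\<And>x. g (x + 1) = g x"
  shows "fourier_coeff (\<lambda>x. g (2 * x)) n = (if even n then fourier_coeff g (n div 2) else 0)"
proof -
  define e where "e = (\<lambda>n (x::real). exp (- 2 * of_real pi * \<i> * of_int n * of_real x) :: complex)"
  define F where "F = (\<lambda>x. g (2 * x) * e n x)"
  have contg: "continuous_on A g" for A using g(1) continuous_on_subset by blast
  have contF: "continuous_on A F" for A
    unfolding F_def e_def by (intro continuous_intros continuous_on_compose2[OF g(1)]) auto
  \<comment> \<open>\<open>s = (-1)\<^sup>n\<close> is the factor that the exponential picks up under translation by \<open>1/2\<close>.\<close>
  define s :: complex where "s = (if even n then 1 else - 1)"
  have "F (x + 1 / 2) = s * F x" for x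
  proof -
    have "e n (x + 1 / 2) = e n x * cis (- (pi * of_int n))"
      by (simp add: e_def cis_conv_exp algebra_simps flip: exp_add)
    also have "cis (- (pi * of_int n)) = s"
    proof (cases "even n")
      case True
      then obtain k where "n = 2 * k" by blast
      then have "pi * of_int n = 2 * pi * of_int k" by simp
      moreover have "cis (- (2 * pi * of_int k)) = 1"
        by (simp add: complex_eq_iff sin_int_2pin cos_int_2pin)
      ultimately show ?thesis using True by (simp only: s_def if_True)
    next
      case False
      then obtain k where "n = 2 * k + 1" using oddE by blast
      then have "pi * of_int n = 2 * pi * of_int k + pi" by (simp add: algebra_simps)
      then show ?thesis using False by (simp add: s_def complex_eq_iff sin_int_2pin cos_int_2pin)
    qed
    moreover have "g (2 * (x + 1 / 2)) = g (2 * x)"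
      using g(2)[of "2 * x"] by (simp add: algebra_simps)
    ultimately show ?thesis by (simp add: F_def)
  qed
  then have "integral {1/2..1} F = integral {0..1/2} (\<lambda>x. s * F x)"
    using integral_shift[of 0 "1/2" "1/2" F] contF by (simp add: o_def)
  then have "integral {0..1} F = integral {0..1/2} F + s * integral {0..1/2} F"
    using Henstock_Kurzweil_Integration.integral_combine[of 0 "1/2" 1 F] integrable_continuous_real[OF contF] by simp
  then have eq: "fourier_coeff (\<lambda>x. g (2 * x)) n = (1 + s) * integral {0..1/2} F"
    by (simp add: fourier_coeff_def F_def e_def algebra_simps)
  show ?thesis
  proof (cases "even n")
    case True
    then obtain k where n: "n = 2 * k" by blast
    have "(\<lambda>x. x / 2) ` {0..1} = {0..1/2 :: real}"
      by (auto simp: image_iff intro!: bexI[of _ "2 * x" for x])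
    then have "integral {0..1/2} F = 1 / 2 * integral {0..1} (\<lambda>x. g x * e k x)"
      using integral_stretch_real[of 2 0 1 "\<lambda>x. g x * e k x"]
      by (simp add: F_def e_def n mult_ac scaleR_conv_of_real)
    also have "integral {0..1} (\<lambda>x. g x * e k x) = fourier_coeff g k"
      by (simp add: fourier_coeff_def e_def)
    finally show ?thesis
      using True by (simp add: eq s_def) (simp add: n mult.commute)
  qed (use eq in \<open>simp add: s_def\<close>)
qed

lemma dist_nearest_int_eq:
  assumes "\<bar>x - of_int k\<bar> \<le> 1 / 2"
  shows "dist_nearest_int x = \<bar>x - of_int k\<bar>"
proof (cases "round x = k")
  case False
  then have "\<bar>round x - k\<bar> \<ge> 1" by linarith
  then have "\<bar>real_of_int (round x) - of_int k\<bar> \<ge> 1" by linarith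
  then show ?thesis
    using assms round_diff_minimal[of x k] unfolding dist_nearest_int_def by linarith
qed (simp add: dist_nearest_int_def)

lemma dist_nearest_int_minus: "dist_nearest_int (- x) = dist_nearest_int x"
  using dist_nearest_int_eq[of "- x" "- round x"] of_int_round_abs_le[of x]
  by (simp add: dist_nearest_int_def abs_minus_commute)

lemma takagi_minus: "takagi (- x) = takagi x"
  by (simp add: takagi_def dist_nearest_int_minus)

lemma takagi_functional_equation: "takagi x = dist_nearest_int x + takagi (2 * x) / 2"
  using suminf_split_head[OF summable_takagi[of x]]
    suminf_mult[OF summable_takagi[of "2 * x"], of "1 / 2"]
  by (simp add: takagi_def mult_ac)

text \<open>
  Integrating the two linear pieces explicitly, with \<open>w = -2\<pi>in\<close>, the boundary terms of order \<open>1/w\<close>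
  cancel by continuity of the function at \<open>1/2\<close> and its vanishing at \<open>0\<close> and \<open>1\<close>. What remains is
  \<open>2 (1 - e\<^sup>w\<^sup>/\<^sup>2) / w\<^sup>2\<close>, and the numerator has norm at most 4.
\<close>
lemma norm_fourier_coeff_dist_nearest_int:
  assumes "n \<noteq> 0"
  shows "norm (fourier_coeff (\<lambda>x. of_real (dist_nearest_int x)) n) \<le> 1 / (pi * of_int n)\<^sup>2"
proof -
  define w :: complex where "w = - 2 * of_real pi * \<i> * of_int n"
  have w: "w \<noteq> 0" using assms by (simp add: w_def)
  have exp_w: "exp w = 1"
    unfolding w_def exp_eq_1 using assms by (auto intro!: exI[of _ "- n"])
  have "((\<lambda>x. of_real x * exp (w * of_real x)) has_integral
     (exp (w * of_real (1/2)) * (of_real (1/2) / w - 1 / w\<^sup>2) - exp (w * of_real 0) * (of_real 0 / w - 1 / w\<^sup>2))) {0..1/2}"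
    by (intro fundamental_theorem_of_calculus has_vector_derivative_real_field)
       (use w in \<open>auto intro!: derivative_eq_intros simp: field_simps power2_eq_square\<close>)
  also have "?this \<longleftrightarrow> ((\<lambda>x. of_real (dist_nearest_int x) * exp (w * of_real x)) has_integral
     (exp (w * of_real (1/2)) * (of_real (1/2) / w - 1 / w\<^sup>2) - exp (w * of_real 0) * (of_real 0 / w - 1 / w\<^sup>2))) {0..1/2}"
    by (intro has_integral_cong) (use dist_nearest_int_eq[of _ 0] in auto)
  finally have 1: \<dots> .
  have "((\<lambda>x. (1 - of_real x) * exp (w * of_real x)) has_integral
     (exp (w * of_real 1) * ((1 - of_real 1) / w + 1 / w\<^sup>2) - exp (w * of_real (1/2)) * ((1 - of_real (1/2)) / w + 1 / w\<^sup>2))) {1/2..1}"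
    by (intro fundamental_theorem_of_calculus has_vector_derivative_real_field)
       (use w in \<open>auto intro!: derivative_eq_intros simp: field_simps power2_eq_square\<close>)
  also have "?this \<longleftrightarrow> ((\<lambda>x. of_real (dist_nearest_int x) * exp (w * of_real x)) has_integral
     (exp (w * of_real 1) * ((1 - of_real 1) / w + 1 / w\<^sup>2) - exp (w * of_real (1/2)) * ((1 - of_real (1/2)) / w + 1 / w\<^sup>2))) {1/2..1}"
    by (intro has_integral_cong) (use dist_nearest_int_eq[of _ 1] in auto)
  finally have 2: \<dots> .
  have "((\<lambda>x. of_real (dist_nearest_int x) * exp (w * of_real x)) has_integral
      (2 / w\<^sup>2 * (1 - exp (w / 2)))) {0..1}"
  proof -
    have "(exp (w * of_real (1/2)) * (of_real (1/2) / w - 1 / w\<^sup>2) - exp (w * of_real 0) * (of_real 0 / w - 1 / w\<^sup>2))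
        + (exp (w * of_real 1) * ((1 - of_real 1) / w + 1 / w\<^sup>2) - exp (w * of_real (1/2)) * ((1 - of_real (1/2)) / w + 1 / w\<^sup>2))
        = 2 / w\<^sup>2 * (1 - exp (w / 2))"
      by (simp add: exp_w) (simp add: algebra_simps diff_divide_distrib)
    with Henstock_Kurzweil_Integration.has_integral_combine[OF _ _ 1 2] show ?thesis by simp
  qed
  then have "fourier_coeff (\<lambda>x. of_real (dist_nearest_int x)) n = 2 / w\<^sup>2 * (1 - exp (w / 2))"
    by (simp add: fourier_coeff_def w_def integral_unique)
  also have "norm \<dots> \<le> 2 / (norm w)\<^sup>2 * 2"
  proof -
    have "norm (exp (w / 2)) = 1" by (simp add: norm_exp_eq_Re w_def)
    then have "norm (1 - exp (w / 2)) \<le> 2"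
      using norm_triangle_ineq4[of 1 "exp (w / 2)"] by simp
    then show ?thesis
      unfolding norm_mult by (intro mult_mono) (auto simp: norm_divide norm_power)
  qed
  also have "\<dots> = 1 / (pi * of_int n)\<^sup>2"
    by (simp add: w_def norm_mult power2_eq_square)
  finally show ?thesis .
qed

text \<open>
  The Fourier transform of the functional equation of the Takagi function.
\<close>
lemma takagi_coeff_recursion:
  "takagi_coeff n = fourier_coeff (\<lambda>x. of_real (dist_nearest_int x)) n
     + (if even n then takagi_coeff (n div 2) / 2 else 0)"
proof -
  let ?e = "\<lambda>x::real. exp (- 2 * of_real pi * \<i> * of_int n * of_real x) :: complex"
  have "((\<lambda>x. of_real (dist_nearest_int x) * ?e x + 1 / 2 * (of_real (takagi (2 * x)) * ?e x)) has_integral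
     (fourier_coeff (\<lambda>x. of_real (dist_nearest_int x)) n
       + 1 / 2 * fourier_coeff (\<lambda>x. of_real (takagi (2 * x))) n)) {0..1}"
    unfolding fourier_coeff_def
    by (intro has_integral_add has_integral_mult_right integrable_integral integrable_continuous_real
        continuous_intros continuous_on_compose2[OF continuous_on_takagi]
        continuous_on_subset[OF continuous_on_dist_nearest_int]) auto
  moreover have "of_real (dist_nearest_int x) * ?e x + 1 / 2 * (of_real (takagi (2 * x)) * ?e x)
      = of_real (takagi x) * ?e x" for x
    by (simp add: takagi_functional_equation[of x] algebra_simps)
  ultimately have "takagi_coeff n = fourier_coeff (\<lambda>x. of_real (dist_nearest_int x)) n
       + 1 / 2 * fourier_coeff (\<lambda>x. of_real (takagi (2 * x))) n"
    by (simp add: takagi_coeff_def fourier_coeff_def integral_unique)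
  moreover have "fourier_coeff (\<lambda>x. of_real (takagi (2 * x))) n
      = (if even n then takagi_coeff (n div 2) else 0)"
    unfolding takagi_coeff_def
    by (rule fourier_coeff_dilate_2)
       (auto intro!: continuous_intros continuous_on_takagi simp: takagi_periodic)
  ultimately show ?thesis by simp
qed

text \<open>
  Each \<open>b k\<close> is used at most once on the right, namely for \<open>n = 2k\<close>, and with weight \<open>1/2\<close>. Hence
  the partial sums \<open>S\<close> of \<open>b\<close> obey \<open>S \<le> \<Sum>t + S / 2\<close>.
\<close>
lemma summable_if_halving_bound:
  fixes b t :: "nat \<Rightarrow> real"
  assumes b: "\<And>n. 0 \<le> b n" and t: "\<And>n. 0 \<le> t n" "summable t"
    and le: "\<And>n. 0 < n \<Longrightarrow> b n \<le> t n + (if even n then b (n div 2) / 2 else 0)"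
  shows "summable (\<lambda>n. b (Suc n))"
proof (rule summableI_nonneg_bounded)
  fix N
  have "(\<Sum>n\<in>{1..N}. b n) \<le> (\<Sum>n\<in>{1..N}. t n + (if even n then b (n div 2) / 2 else 0))"
    by (intro sum_mono le) auto
  also have "\<dots> = (\<Sum>n\<in>{1..N}. t n) + (\<Sum>n\<in>{n\<in>{1..N}. even n}. b (n div 2) / 2)"
    unfolding sum.distrib by (subst sum.inter_filter) auto
  also have "(\<Sum>n\<in>{n\<in>{1..N}. even n}. b (n div 2) / 2) = (\<Sum>k\<in>{1..N div 2}. b k / 2)"
    by (rule sum.reindex_bij_witness[of _ "\<lambda>k. 2 * k" "\<lambda>n. n div 2"]) auto
  also have "\<dots> \<le> (\<Sum>k\<in>{1..N}. b k / 2)"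
    by (intro sum_mono2) (use b in auto)
  also have "\<dots> = (\<Sum>k\<in>{1..N}. b k) / 2" by (simp add: sum_divide_distrib)
  also have "(\<Sum>n\<in>{1..N}. t n) \<le> suminf t"
    by (intro sum_le_suminf t) auto
  finally have "(\<Sum>n\<in>{1..N}. b n) \<le> 2 * suminf t" by simp
  moreover have "(\<Sum>n<N. b (Suc n)) = (\<Sum>n\<in>{1..N}. b n)"
    by (simp add: sum.atLeast1_atMost_eq)
  ultimately show "(\<Sum>n<N. b (Suc n)) \<le> 2 * suminf t" by simp
qed (use b in auto)

lemma summable_takagi_coeff: "summable (\<lambda>n. norm (takagi_coeff (int (Suc n))))"
proof (rule summable_if_halving_bound[where t = "\<lambda>n. 1 / (pi * real n)\<^sup>2" and b = "\<lambda>n. norm (takagi_coeff (int n))"])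
  have "summable (\<lambda>n. 1 / pi\<^sup>2 * inverse (real n ^ 2))"
    by (intro summable_mult inverse_power_summable) auto
  then show "summable (\<lambda>n. 1 / (pi * real n)\<^sup>2)"
    by (simp add: power_mult_distrib divide_simps)
next
  fix n :: nat assume "0 < n"
  then show "norm (takagi_coeff (int n)) \<le> 1 / (pi * real n)\<^sup>2 +
      (if even n then norm (takagi_coeff (int (n div 2))) / 2 else 0)"
    using norm_fourier_coeff_dist_nearest_int[of "int n"]
    by (subst takagi_coeff_recursion)
       (auto simp: zdiv_int norm_divide intro!: norm_triangle_le)
qed auto

section \<open>The power series on the closed disk\<close>

lemma takagi_power_series_uniform_limit:
  "uniform_limit (cball 0 1)
     (\<lambda>N z. 1 / 2 * takagi_coeff 0 + (\<Sum>n<N. takagi_coeff (int (Suc n)) * z ^ Suc n))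
     takagi_power_series sequentially"
  unfolding takagi_power_series_def[abs_def]
proof (intro uniform_limit_add uniform_limit_const Weierstrass_m_test[OF _ summable_takagi_coeff])
  fix n :: nat and z :: complex
  assume "z \<in> cball 0 1"
  then show "norm (takagi_coeff (int (Suc n)) * z ^ Suc n) \<le> norm (takagi_coeff (int (Suc n)))"
    unfolding norm_mult norm_power by (intro mult_left_le power_le_one) auto
qed

lemma
  continuous_on_takagi_power_series: "continuous_on (cball 0 1) takagi_power_series" and
  holomorphic_on_takagi_power_series: "takagi_power_series holomorphic_on ball 0 1"
proof -
  have "eventually (\<lambda>N. continuous_on (cball 0 1)
        (\<lambda>z. 1 / 2 * takagi_coeff 0 + (\<Sum>n<N. takagi_coeff (int (Suc n)) * z ^ Suc n)) \<and>
      (\<lambda>z. 1 / 2 * takagi_coeff 0 + (\<Sum>n<N. takagi_coeff (int (Suc n)) * z ^ Suc n)) holomorphic_on ball 0 1)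
      sequentially"
    by (auto intro!: always_eventually continuous_intros holomorphic_intros)
  from holomorphic_uniform_limit[OF this takagi_power_series_uniform_limit]
  show "continuous_on (cball 0 1) takagi_power_series" "takagi_power_series holomorphic_on ball 0 1"
    by auto
qed

lemma summable_takagi_power_series:
  assumes "z \<in> cball 0 1"
  shows "summable (\<lambda>n. norm (takagi_coeff (int (Suc n)) * z ^ Suc n))"
proof (rule summable_comparison_test'[OF summable_takagi_coeff])
  fix n :: nat
  have "norm (takagi_coeff (int (Suc n)) * z ^ Suc n) \<le> norm (takagi_coeff (int (Suc n)))"
    using assms unfolding norm_mult norm_power by (intro mult_left_le power_le_one) auto
  then show "norm (norm (takagi_coeff (int (Suc n)) * z ^ Suc n)) \<le> norm (takagi_coeff (int (Suc n)))"
    by (simp only: real_norm_def abs_norm_cancel)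
qed

lemma takagi_coeff_eq_cos_coeff: "takagi_coeff (int n) = of_real (cos_coeff takagi n)"
  unfolding takagi_coeff_def
  by (rule fourier_coeff_even_real[OF continuous_on_takagi takagi_minus takagi_periodic])

text \<open>
  As the coefficients are real, the real part of the power series on the circle is the cosine series
  of the Takagi function, halved.
\<close>
lemma Re_takagi_power_series_cis: "Re (takagi_power_series (cis (2 * pi * \<theta>))) = takagi \<theta> / 2"
proof -
  have "summable (\<lambda>n. takagi_coeff (int (Suc n)) * cis (2 * pi * \<theta>) ^ Suc n)"
    by (rule summable_norm_cancel[OF summable_takagi_power_series]) simp
  then have "(\<lambda>n. Re (takagi_coeff (int (Suc n)) * cis (2 * pi * \<theta>) ^ Suc n)) sums
      Re (\<Sum>n. takagi_coeff (int (Suc n)) * cis (2 * pi * \<theta>) ^ Suc n)"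
    by (intro sums_Re summable_sums)
  moreover have "Re (takagi_coeff (int (Suc n)) * cis (2 * pi * \<theta>) ^ Suc n)
      = cos_coeff takagi (Suc n) * cos (2 * pi * real (Suc n) * \<theta>)" for n
    unfolding takagi_coeff_eq_cos_coeff Complex.DeMoivre by (simp add: mult_ac)
  ultimately have "(\<lambda>n. cos_coeff takagi (Suc n) * cos (2 * pi * real (Suc n) * \<theta>)) sums
      Re (\<Sum>n. takagi_coeff (int (Suc n)) * cis (2 * pi * \<theta>) ^ Suc n)"
    by (simp only:)
  moreover have "(\<lambda>n. 2 * cos_coeff takagi (Suc n) * cos (2 * pi * real (Suc n) * \<theta>)) sums
      (takagi \<theta> - cos_coeff takagi 0)"
    using summable_takagi_coeff unfolding takagi_coeff_eq_cos_coeff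
    by (intro cosine_series_sums continuous_on_takagi takagi_minus takagi_periodic) simp
  from sums_divide[OF this, of 2]
  have "(\<lambda>n. cos_coeff takagi (Suc n) * cos (2 * pi * real (Suc n) * \<theta>)) sums
      ((takagi \<theta> - cos_coeff takagi 0) / 2)"
    by simp
  ultimately have "Re (\<Sum>n. takagi_coeff (int (Suc n)) * cis (2 * pi * \<theta>) ^ Suc n)
      = (takagi \<theta> - cos_coeff takagi 0) / 2"
    by (rule sums_unique2)
  moreover have "takagi_coeff 0 = of_real (cos_coeff takagi 0)"
    using takagi_coeff_eq_cos_coeff[of 0] by simp
  ultimately show ?thesis
    unfolding takagi_power_series_def by (simp add: field_simps)
qed

section \<open>The natural boundary\<close>

text \<open>
  Let \<open>h = 2\<^sup>-\<^sup>M\<close> be the increment. The summand \<open>2\<^sup>-\<^sup>n d(2\<^sup>n x)\<close> of the Takagi function changes by \<open>h\<close> when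
  \<open>N \<le> n < M\<close>, because \<open>2\<^sup>n x\<close> is then an integer and \<open>d\<close> increases with slope 1 to the right of it.
  For \<open>n \<ge> M\<close> the argument moves by an integer and nothing changes. Each of the first \<open>N\<close> summands
  loses at most \<open>h\<close>, being 1-Lipschitz. In total the quotient is at least \<open>(M - N) - N\<close>.
\<close>
lemma takagi_dyadic_difference_quotient:
  fixes k :: int and M N :: nat
  defines "x \<equiv> of_int k / 2 ^ N"
  assumes "N \<le> M"
  shows "real M - 2 * real N \<le> (takagi (x + 1 / 2 ^ M) - takagi x) / (1 / 2 ^ M)"
proof -
  define h :: real where "h = 1 / 2 ^ M"
  define u where "u = (\<lambda>n. 1 / 2 ^ n * dist_nearest_int (2 ^ n * (x + h)) - 1 / 2 ^ n * dist_nearest_int (2 ^ n * x))"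
  have int: "2 ^ n * x = of_int (k * 2 ^ (n - N))" if "N \<le> n" for n
  proof -
    have "(2 :: real) ^ n = 2 ^ N * 2 ^ (n - N)" using that by (simp flip: power_add)
    then show ?thesis by (simp add: x_def)
  qed
  \<comment> \<open>\<open>u n\<close> is the change of the \<open>n\<close>-th summand from \<open>x\<close> to \<open>x + h\<close>.\<close>
  have low: "u n \<ge> - h" for n
  proof -
    have "dist_nearest_int (2 ^ n * x) - dist_nearest_int (2 ^ n * (x + h)) \<le> 2 ^ n * h"
      using dist_nearest_int_lipschitz[of "2 ^ n * x" "2 ^ n * (x + h)"] by (simp add: algebra_simps h_def)
    then show ?thesis by (simp add: u_def field_simps)
  qed
  have mid: "u n = h" if "N \<le> n" "n < M" for n
  proof -
    have le: "2 ^ n * h \<le> 1 / 2"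
      using power_increasing[of "Suc n" M "2::real"] that by (simp add: h_def field_simps)
    have "dist_nearest_int (2 ^ n * (x + h)) = dist_nearest_int (2 ^ n * h + of_int (k * 2 ^ (n - N)))"
      by (simp only: distrib_left int[OF that(1)] add.commute)
    also have "\<dots> = dist_nearest_int (2 ^ n * h)"
      by (rule dist_nearest_int_add_int)
    also have "\<dots> = 2 ^ n * h"
      using dist_nearest_int_eq[of "2 ^ n * h" 0] le by (simp add: h_def)
    finally have "dist_nearest_int (2 ^ n * (x + h)) = 2 ^ n * h" .
    moreover have "dist_nearest_int (2 ^ n * x) = 0"
      unfolding int[OF that(1)] dist_nearest_int_def round_of_int by simp
    ultimately show ?thesis by (simp add: u_def)
  qed
  have high: "u n = 0" if "M \<le> n" for n
  proof -
    have "2 ^ n * h = of_int (2 ^ (n - M))"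
    proof -
      have "(2 :: real) ^ n = 2 ^ M * 2 ^ (n - M)" using that by (simp flip: power_add)
      then show ?thesis by (simp add: h_def)
    qed
    then have "2 ^ n * (x + h) = 2 ^ n * x + of_int (2 ^ (n - M))"
      by (simp only: distrib_left)
    then show ?thesis
      by (simp only: u_def dist_nearest_int_add_int)
  qed
  have "takagi (x + h) - takagi x = (\<Sum>n. u n)"
    unfolding takagi_def u_def by (rule suminf_diff[OF summable_takagi summable_takagi])
  also have "\<dots> = (\<Sum>n\<in>{0..<M}. u n)"
    by (rule suminf_finite) (use high in auto)
  also have "\<dots> = (\<Sum>n\<in>{0..<N}. u n) + (\<Sum>n\<in>{N..<M}. u n)"
    using assms(2) by (simp add: sum.atLeastLessThan_concat)
  also have "(\<Sum>n\<in>{N..<M}. u n) = (real M - real N) * h"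
    using mid assms(2) by (simp add: of_nat_diff)
  finally have "takagi (x + h) - takagi x = (\<Sum>n\<in>{0..<N}. u n) + (real M - real N) * h" .
  moreover have "(\<Sum>n\<in>{0..<N}. u n) \<ge> (\<Sum>n\<in>{0..<N}. - h)"
    by (intro sum_mono low)
  ultimately have "takagi (x + h) - takagi x \<ge> (real M - 2 * real N) * h"
    by (simp add: algebra_simps)
  then show ?thesis
    by (simp add: h_def field_simps)
qed

lemma takagi_not_differentiable_at_dyadic:
  "\<not> (takagi has_real_derivative L) (at (of_int k / 2 ^ N))"
proof
  define x :: real where "x = of_int k / 2 ^ N"
  assume "(takagi has_real_derivative L) (at (of_int k / 2 ^ N))"
  then have "(\<lambda>h. (takagi (x + h) - takagi x) / h) \<midarrow>0\<rightarrow> L"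
    by (simp add: DERIV_def x_def)
  moreover have "filterlim (\<lambda>M. 1 / 2 ^ M :: real) (at 0) sequentially"
    by real_asymp
  ultimately have "(\<lambda>M. (takagi (x + 1 / 2 ^ M) - takagi x) / (1 / 2 ^ M)) \<longlonglongrightarrow> L"
    by (rule filterlim_compose)
  moreover have "filterlim (\<lambda>M. (takagi (x + 1 / 2 ^ M) - takagi x) / (1 / 2 ^ M)) at_top sequentially"
  proof (rule filterlim_at_top_mono)
    show "filterlim (\<lambda>M. real M - 2 * real N) at_top sequentially" by real_asymp
    show "\<forall>\<^sub>F M in sequentially. real M - 2 * real N \<le> (takagi (x + 1 / 2 ^ M) - takagi x) / (1 / 2 ^ M)"
      unfolding x_def by (intro eventually_sequentiallyI[of N] takagi_dyadic_difference_quotient)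
  qed
  ultimately show False
    using not_tendsto_and_filterlim_at_infinity[of sequentially] filterlim_at_top_imp_at_infinity
    by (metis trivial_limit_sequentially)
qed

lemma dyadic_between:
  fixes a b :: real
  assumes "a < b"
  obtains k :: int and N :: nat where "a < of_int k / 2 ^ N" "of_int k / 2 ^ N < b"
proof -
  obtain N where N: "(1 / 2) ^ N < b - a"
    using real_arch_pow_inv[of "b - a" "1 / 2"] assms by auto
  \<comment> \<open>The first multiple of \<open>2\<^sup>-\<^sup>N\<close> beyond \<open>a\<close> is reached before \<open>b\<close>.\<close>
  define k where "k = \<lfloor>a * 2 ^ N\<rfloor> + 1"
  have "a * 2 ^ N < of_int k" "of_int k \<le> a * 2 ^ N + 1"
    unfolding k_def by linarith+
  moreover have "a * 2 ^ N + 1 < b * 2 ^ N"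
    using N by (simp add: field_simps power_one_over)
  ultimately show thesis
    by (intro that[of k N]) (auto simp: field_simps)
qed

text \<open>
  Both functions are continuous at \<open>w\<close> along the radius that ends there, on which they agree near \<open>w\<close>.
\<close>
lemma continuation_eq_on_circle:
  fixes f g :: "complex \<Rightarrow> 'a :: t2_space"
  assumes f: "continuous_on (cball 0 1) f" and U: "open U" "continuous_on U g"
    and eq: "\<forall>z\<in>U \<inter> ball 0 1. g z = f z" and w: "w \<in> U" "norm w = 1"
  shows "g w = f w"
proof -
  define z where "z = (\<lambda>n. of_real (1 - 1 / real (Suc n)) * w)"
  have zball: "z n \<in> ball 0 1" for n
    using w by (simp add: z_def norm_mult del: of_real_diff of_real_divide)
  have "(\<lambda>n. 1 - 1 / real (Suc n)) \<longlonglongrightarrow> 1" by real_asymp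
  then have "z \<longlonglongrightarrow> of_real 1 * w"
    unfolding z_def by (intro tendsto_mult tendsto_of_real tendsto_const)
  then have zw: "z \<longlonglongrightarrow> w" by simp
  have "(\<lambda>n. g (z n)) \<longlonglongrightarrow> g w"
    using U w zw continuous_on_eq_continuous_at isCont_tendsto_compose by metis
  moreover have "eventually (\<lambda>n. z n \<in> U) sequentially"
    using topological_tendstoD[OF zw U(1) w(1)] .
  then have "eventually (\<lambda>n. g (z n) = f (z n)) sequentially"
    by eventually_elim (use eq zball in auto)
  ultimately have "(\<lambda>n. f (z n)) \<longlonglongrightarrow> g w"
    by (rule Lim_transform_eventually)
  moreover have "(\<lambda>n. f (z n)) \<longlonglongrightarrow> f w"
  proof (rule continuous_on_tendsto_compose[OF f zw])
    show "w \<in> cball 0 1" "eventually (\<lambda>n. z n \<in> cball 0 1) sequentially"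
      using w less_imp_le[OF zball[unfolded mem_ball]] by (auto intro!: always_eventually)
  qed
  ultimately show ?thesis
    by (rule LIMSEQ_unique)
qed

lemma natural_boundary_takagi_power_series: "unit_circle_natural_boundary takagi_power_series"
  unfolding unit_circle_natural_boundary_def
proof (intro conjI allI impI notI)
  show "takagi_power_series holomorphic_on ball 0 1"
    by (rule holomorphic_on_takagi_power_series)
next
  fix a b :: real
  assume "a < b" "continues_analytically_across takagi_power_series (cis ` {a<..<b})"
  then obtain U g where U: "open U" "cis ` {a<..<b} \<subseteq> U" and g: "g holomorphic_on U"
    and eq: "\<forall>z\<in>U \<inter> ball 0 1. g z = takagi_power_series z"
    unfolding continues_analytically_across_def by blast
  have "a / (2 * pi) < b / (2 * pi)" using \<open>a < b\<close> by (simp add: divide_strict_right_mono)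
  then obtain k :: int and N where kN: "a / (2 * pi) < of_int k / 2 ^ N" "of_int k / 2 ^ N < b / (2 * pi)"
    by (rule dyadic_between)
  define x :: real where "x = of_int k / 2 ^ N"
  define I where "I = {a / (2 * pi)<..<b / (2 * pi)}"
  have in_U: "cis (2 * pi * y) \<in> U" if "y \<in> I" for y
    using that U(2) by (auto simp: I_def field_simps)
  have tak: "2 * Re (g (cis (2 * pi * y))) = takagi y" if "y \<in> I" for y
    using continuation_eq_on_circle[OF continuous_on_takagi_power_series U(1)
        holomorphic_on_imp_continuous_on[OF g] eq in_U[OF that]]
    by (simp add: Re_takagi_power_series_cis)
  have x: "x \<in> I" using kN by (simp add: I_def x_def)
  have "(g has_field_derivative deriv g (cis (2 * pi * x))) (at (cis (2 * pi * x)))"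
    using holomorphic_derivI[OF g U(1) in_U[OF x]] .
  moreover have "((\<lambda>y. cis (2 * pi * y)) has_vector_derivative (2 * pi * \<i> * cis (2 * pi * x))) (at x)"
    unfolding cis_conv_exp
    by (auto intro!: derivative_eq_intros has_vector_derivative_real_field simp: mult_ac)
  ultimately have "((g \<circ> (\<lambda>y. cis (2 * pi * y))) has_vector_derivative
      (2 * pi * \<i> * cis (2 * pi * x)) * deriv g (cis (2 * pi * x))) (at x)"
    by (intro field_vector_diff_chain_at)
  from bounded_linear.has_vector_derivative[OF bounded_linear_Re this]
  have "((\<lambda>y. Re (g (cis (2 * pi * y)))) has_real_derivative
      Re ((2 * pi * \<i> * cis (2 * pi * x)) * deriv g (cis (2 * pi * x)))) (at x)"
    by (simp add: has_real_derivative_iff_has_vector_derivative o_def)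
  from DERIV_cmult[OF this, of 2] obtain L where
    "((\<lambda>y. 2 * Re (g (cis (2 * pi * y)))) has_real_derivative L) (at x)" by blast
  moreover have "open I" by (simp add: I_def)
  ultimately have "(takagi has_real_derivative L) (at x)"
    using has_field_derivative_transform_within_open[OF _ _ x] tak by blast
  then show False
    using takagi_not_differentiable_at_dyadic by (simp add: x_def)
qed

theorem theorem6p2:
  shows "(\<forall>z\<in>cball 0 1. summable (\<lambda>n. norm (takagi_coeff (int (Suc n)) * z ^ Suc n))) \<and>
    takagi_power_series holomorphic_on ball 0 1 \<and>
    unit_circle_natural_boundary takagi_power_series \<and>
    continuous_on (sphere 0 1) takagi_power_series \<and>
    (\<exists>X Y :: real \<Rightarrow> real.
       (\<forall>\<theta>. takagi_power_series (exp (2 * of_real pi * \<i> * of_real \<theta>)) =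
              1 / 2 * (of_real (X \<theta>) + \<i> * of_real (Y \<theta>))) \<and>
       (\<forall>\<theta>. X \<theta> = takagi \<theta>))"
proof (intro conjI)
  show "\<forall>z\<in>cball 0 1. summable (\<lambda>n. norm (takagi_coeff (int (Suc n)) * z ^ Suc n))"
    using summable_takagi_power_series by blast
  show "takagi_power_series holomorphic_on ball 0 1"
    by (rule holomorphic_on_takagi_power_series)
  show "unit_circle_natural_boundary takagi_power_series"
    by (rule natural_boundary_takagi_power_series)
  show "continuous_on (sphere 0 1) takagi_power_series"
    by (rule continuous_on_subset[OF continuous_on_takagi_power_series]) auto
  define Y where "Y = (\<lambda>\<theta>. 2 * Im (takagi_power_series (cis (2 * pi * \<theta>))))"
  have "takagi_power_series (exp (2 * of_real pi * \<i> * of_real \<theta>)) =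
      1 / 2 * (of_real (takagi \<theta>) + \<i> * of_real (Y \<theta>))" for \<theta>
  proof -
    have "exp (2 * of_real pi * \<i> * of_real \<theta>) = cis (2 * pi * \<theta>)"
      by (simp add: cis_conv_exp mult_ac)
    then show ?thesis
      by (simp only:) (simp add: complex_eq_iff Re_takagi_power_series_cis Y_def)
  qed
  then show "\<exists>X Y :: real \<Rightarrow> real.
       (\<forall>\<theta>. takagi_power_series (exp (2 * of_real pi * \<i> * of_real \<theta>)) =
              1 / 2 * (of_real (X \<theta>) + \<i> * of_real (Y \<theta>))) \<and>
       (\<forall>\<theta>. X \<theta> = takagi \<theta>)"
    by blast
qed

end
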